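(* There are unsatisfiable $k$-CNF formulas $F$ with $\mathrm{occ}_F(x) \cdot \mathrm{occ}_F(\bar{x}) \in O(3.01^k)$ for all variables $x$.
   Context: A CNF formula is a set of clauses, each a set of literals (no repeated literal, no variable together with its negation); a $k$-CNF formula has all clauses of size exactly $k$. For a literal $u$, $\mathrm{occ}_F(u)$ denotes the number of clauses of $F$ containing $u$. *)

theory Defs
  imports Complex_Main "HOL-Library.Landau_Symbols"
begin

datatype 'v literal = Pos 'v | Neg 'v

type_synonym 'v clause = "'v literal set"
type_synonym 'v cnf = "'v clause set"

definition is_clause :: "'v clause \<Rightarrow> bool" where
  "is_clause C \<longleftrightarrow> finite C \<and> (\<forall>x. \<not> (Pos x \<in> C \<and> Neg x \<in> C))"

definition is_cnf :: "'v cnf \<Rightarrow> bool" where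
  "is_cnf F \<longleftrightarrow> finite F \<and> (\<forall>C\<in>F. is_clause C)"

definition is_k_cnf :: "nat \<Rightarrow> 'v cnf \<Rightarrow> bool" where
  "is_k_cnf k F \<longleftrightarrow> is_cnf F \<and> (\<forall>C\<in>F. card C = k)"

definition occ :: "'v cnf \<Rightarrow> 'v literal \<Rightarrow> nat" where
  "occ F u = card {C \<in> F. u \<in> C}"

fun lit_true :: "('v \<Rightarrow> bool) \<Rightarrow> 'v literal \<Rightarrow> bool" where
  "lit_true \<alpha> (Pos x) \<longleftrightarrow> \<alpha> x"
| "lit_true \<alpha> (Neg x) \<longleftrightarrow> \<not> \<alpha> x"

definition satisfies :: "('v \<Rightarrow> bool) \<Rightarrow> 'v cnf \<Rightarrow> bool" where
  "satisfies \<alpha> F \<longleftrightarrow> (\<forall>C\<in>F. \<exists>u\<in>C. lit_true \<alpha> u)"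

definition satisfiable :: "'v cnf \<Rightarrow> bool" where
  "satisfiable F \<longleftrightarrow> (\<exists>\<alpha>. satisfies \<alpha> F)"

end

theory Submission imports Defs "HOL-Library.Nat_Bijection" "HOL-Real_Asymp.Real_Asymp" begin

text \<open>
  Call an assignment of n main variables \<^emph>\<open>light\<close> if it has at least about (1 - p) n zeros;
  otherwise it has at least about p n ones. Averaging shows that n (1 - p)^(-m) positive clauses of
  size m, up to a constant, falsify all light assignments, and n p^(-k) negative clauses of size k
  all the others. Each positive clause is padded to size k by all sign patterns on k - m fresh
  variables of its own. The product of occurrences is then at most 4^(k-m) for a fresh variable,
  and about n^2 (2 / p)^k (2 (1 - p))^(-m) for a main one. With m = 7k/34 and p close to
  34/41 (the minimiser of the second bound), both are below 3.01^k. It suffices that n is a large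
  multiple of k: sampling without replacement lowers the densities 3415/20000 and 16585/20000 of
  the two cases only to 0.1707 and 0.8292.
\<close>

section \<open>Greedy covering by few subsets\<close>

text \<open>Double counting: if every \<open>s\<close> is related to at least a fraction
  \<open>q\<close> of \<open>T\<close>, then some \<open>t\<close> is related to at least a fraction
  \<open>q\<close> of the \<open>s\<close> still uncovered. Each greedy choice therefore shrinks the
  uncovered set by a factor \<open>1 - q\<close>.\<close>

lemma greedy_cover:
  fixes R :: "'a \<Rightarrow> 'b \<Rightarrow> bool" and q :: real
  assumes S: "finite S" and T: "finite T" "T \<noteq> {}" and q: "q \<le> 1"
    and deg: "\<And>s. s \<in> S \<Longrightarrow> q * card T \<le> card {t \<in> T. R s t}"
  shows "\<exists>T' \<subseteq> T. card T' \<le> N \<and> card {s \<in> S. \<forall>t \<in> T'. \<not> R s t} \<le> (1 - q) ^ N * card S"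
proof (induction N)
  case 0
  show ?case by (rule exI[of _ "{}"]) simp
next
  case (Suc N)
  then obtain T' where T': "T' \<subseteq> T" "card T' \<le> N"
    and bnd: "card {s \<in> S. \<forall>t \<in> T'. \<not> R s t} \<le> (1 - q) ^ N * card S"
    by blast
  define U where "U = {s \<in> S. \<forall>t \<in> T'. \<not> R s t}"
  have fU: "finite U" and US: "U \<subseteq> S" using S by (auto simp: U_def)
  have "q * card T * card U = (\<Sum>s\<in>U. q * card T)" by simp
  also have "\<dots> \<le> (\<Sum>s\<in>U. real (card {t \<in> T. R s t}))"
    using deg US by (intro sum_mono) auto
  also have "\<dots> = (\<Sum>s\<in>U. \<Sum>t\<in>T. if R s t then 1 else 0)"
    using T by (intro sum.cong) (auto simp: sum.If_cases Int_def)
  also have "\<dots> = (\<Sum>t\<in>T. \<Sum>s\<in>U. if R s t then 1 else 0)"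
    by (rule sum.swap)
  also have "\<dots> = (\<Sum>t\<in>T. real (card {s \<in> U. R s t}))"
    using fU by (intro sum.cong) (auto simp: sum.If_cases Int_def)
  finally have avg: "q * card T * card U \<le> (\<Sum>t\<in>T. real (card {s \<in> U. R s t}))" .
  \<comment> \<open>If every \<open>t\<close> fell short of the average, summing over the nonempty
    \<open>T\<close> would contradict \<open>avg\<close>.\<close>
  obtain t where t: "t \<in> T" "q * card U \<le> card {s \<in> U. R s t}"
  proof (rule ccontr)
    assume "\<not> thesis"
    then have lt: "\<And>t. t \<in> T \<Longrightarrow> card {s \<in> U. R s t} < q * card U"
      using that by (meson not_le)
    have "(\<Sum>t\<in>T. real (card {s \<in> U. R s t})) < (\<Sum>t\<in>T. q * card U)"
      using T lt by (intro sum_strict_mono) auto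
    with avg show False by (simp add: mult_ac)
  qed
  have "{s \<in> S. \<forall>t' \<in> insert t T'. \<not> R s t'} = U - {s \<in> U. R s t}"
    by (auto simp: U_def)
  then have "card {s \<in> S. \<forall>t' \<in> insert t T'. \<not> R s t'} = card U - card {s \<in> U. R s t}"
    using fU by (simp add: card_Diff_subset)
  then have "real (card {s \<in> S. \<forall>t' \<in> insert t T'. \<not> R s t'}) = real (card U) - card {s \<in> U. R s t}"
    using card_mono[OF fU, of "{s \<in> U. R s t}"] by (simp add: of_nat_diff)
  also have "\<dots> \<le> (1 - q) * card U"
    using t by (simp add: algebra_simps)
  also have "\<dots> \<le> (1 - q) * ((1 - q) ^ N * card S)"
    using bnd q by (intro mult_left_mono) (auto simp: U_def)
  finally have "real (card {s \<in> S. \<forall>t' \<in> insert t T'. \<not> R s t'}) \<le> (1 - q) ^ Suc N * card S"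
    by simp
  moreover have "card (insert t T') \<le> Suc N"
    using T' finite_subset[OF T'(1) T(1)] by (simp add: card_insert_if)
  ultimately show ?case
    using T' t by (intro exI[of _ "insert t T'"]) auto
qed

text \<open>The quotient of the two binomials is the product of \<open>(z - i) / (n - i)\<close>
  over \<open>i < m\<close>. The slack \<open>m\<close> in the lower bound for \<open>z\<close>
  keeps each factor at least \<open>r\<close>, which makes up for sampling without
  replacement.\<close>

lemma binomial_ratio_ge:
  fixes r :: real and n m z :: nat
  assumes "0 \<le> r" "r * n + m \<le> z" "m \<le> n"
  shows "r ^ m * (n choose m) \<le> z choose m"
  using assms(2,3)
proof (induction m)
  case 0
  then show ?case by simp
next
  case (Suc m)
  have *: "real (a choose Suc m) = (a choose m) * (real a - m) / Suc m" for a :: nat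
  proof (cases "m \<le> a")
    case True
    have "Suc m * (a choose Suc m) = (a choose m) * (a - m)"
      by (metis binomial_absorb_comp binomial_absorption mult.commute)
    then have "real (Suc m) * (a choose Suc m) = (a choose m) * (real a - m)"
      using True by (metis of_nat_diff of_nat_mult)
    then show ?thesis by (simp add: field_simps)
  qed (simp add: binomial_eq_0)
  have "r * (real n - m) \<le> real z - m"
    using Suc.prems assms(1) by (simp add: algebra_simps)
       (smt (verit) mult_nonneg_nonneg of_nat_0_le_iff)
  moreover have "r ^ m * (n choose m) \<le> z choose m"
    using Suc by simp
  ultimately have "(r ^ m * (n choose m)) * (r * (real n - m)) \<le> (z choose m) * (real z - m)"
    using Suc.prems assms(1) by (intro mult_mono) auto
  then have "(r ^ m * (n choose m)) * (r * (real n - m)) / Suc m \<le> (z choose m) * (real z - m) / Suc m"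
    by (rule divide_right_mono) simp
  then show ?case
    unfolding * by (simp add: mult_ac)
qed

text \<open>A set of size at least \<open>z\<close> contains a fraction at least
  \<open>r ^ m\<close> of all \<open>m\<close>-subsets, so the greedy choice applies to the at most
  \<open>2 ^ n\<close> such sets.\<close>

lemma small_subset_cover:
  fixes r :: real and n m z :: nat
  assumes r: "0 < r" "r \<le> 1" and z: "r * n + m \<le> z" and mn: "m \<le> n"
  shows "\<exists>P. (\<forall>C\<in>P. C \<subseteq> {..<n} \<and> card C = m) \<and> finite P \<and> card P \<le> (n + 2) / r ^ m \<and>
             (\<forall>Z \<subseteq> {..<n}. z \<le> card Z \<longrightarrow> (\<exists>C\<in>P. C \<subseteq> Z))"
proof -
  define S where "S = {Z. Z \<subseteq> {..<n} \<and> z \<le> card Z}"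
  define T where "T = {C. C \<subseteq> {..<n} \<and> card C = m}"
  define q where "q = r ^ m"
  \<comment> \<open>With this many rounds \<open>(1 - q) ^ N\<close> is at most
    \<open>exp (- (n + 1))\<close>, and fewer than one of the \<open>2 ^ n\<close> sets stays
    uncovered. Using \<open>n + 1\<close> instead of \<open>n\<close> makes this strict even for
    \<open>n = 0\<close>; rounding up costs at most \<open>1 / q\<close>.\<close>
  define N where "N = nat \<lceil>(n + 1) / q\<rceil>"
  have q: "0 < q" "q \<le> 1" using r by (auto simp: q_def power_le_one)
  have S: "finite S" and T: "finite T" by (auto simp: S_def T_def)
  have cT: "card T = n choose m"
    unfolding T_def by (simp add: n_subsets)
  with mn have "T \<noteq> {}" by (metis binomial_eq_0_iff card.empty not_less)
  have "card S \<le> card (Pow {..<n})" by (intro card_mono) (auto simp: S_def)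
  then have cS: "real (card S) \<le> 2 ^ n"
    by (simp add: card_Pow of_nat_le_iff[of _ "2 ^ n", where ?'a = real, simplified])
  have deg: "q * card T \<le> card {C \<in> T. C \<subseteq> Z}" if "Z \<in> S" for Z
  proof -
    have fZ: "finite Z" using that by (auto simp: S_def intro: finite_subset)
    have "{C \<in> T. C \<subseteq> Z} = {C. C \<subseteq> Z \<and> card C = m}"
      using that by (auto simp: S_def T_def)
    then have "card {C \<in> T. C \<subseteq> Z} = card Z choose m"
      using n_subsets[OF fZ] by simp
    moreover have "r * n + m \<le> card Z" using z that by (simp add: S_def)
    ultimately show ?thesis
      using binomial_ratio_ge[of r n m "card Z"] r mn by (simp add: q_def cT)
  qed
  from greedy_cover[where R = "\<lambda>Z C. C \<subseteq> Z", OF S T \<open>T \<noteq> {}\<close> q(2) deg, of N]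
  obtain P where P: "P \<subseteq> T" "card P \<le> N"
    and unc: "card {Z \<in> S. \<forall>C\<in>P. \<not> C \<subseteq> Z} \<le> (1 - q) ^ N * card S"
    by auto
  have N: "(n + 1) / q \<le> N" "N \<le> (n + 1) / q + 1"
    using q unfolding N_def by (auto intro: real_nat_ceiling_ge simp: of_nat_nat)
  have "(1 - q) ^ N \<le> exp (- q) ^ N"
    using q exp_ge_add_one_self[of "- q"] by (intro power_mono) auto
  also have "\<dots> = exp (- (q * N))" by (simp add: exp_of_nat_mult[symmetric] mult.commute)
  also have "\<dots> \<le> exp (- real (n + 1))" using N q by (simp add: field_simps)
  finally have "(1 - q) ^ N * card S \<le> exp (- real (n + 1)) * 2 ^ n"
    using cS by (intro mult_mono) auto
  also have "\<dots> < exp (- real (n + 1)) * 2 ^ (n + 1)" by simp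
  also have "\<dots> \<le> exp (- real (n + 1)) * exp 1 ^ (n + 1)"
    using exp_ge_add_one_self[of 1] by (intro mult_left_mono power_mono) auto
  also have "\<dots> = 1"
    by (simp only: exp_of_nat_mult[symmetric] flip: exp_add) simp
  finally have "card {Z \<in> S. \<forall>C\<in>P. \<not> C \<subseteq> Z} = 0"
    using unc by linarith
  then have "{Z \<in> S. \<forall>C\<in>P. \<not> C \<subseteq> Z} = {}" using S by simp
  moreover have "card P \<le> (n + 2) / r ^ m"
  proof -
    have "real (card P) \<le> (n + 1) / q + 1 / q"
      using P N q by (smt (verit) divide_le_eq_1_pos le_divide_eq_1_pos of_nat_le_iff)
    then show ?thesis by (simp add: q_def add_divide_distrib)
  qed
  ultimately show ?thesis
    using P T by (intro exI[of _ P]) (auto simp: S_def T_def finite_subset)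
qed

section \<open>The formula and its occurrence counts\<close>

text \<open>First component 0 is reserved for main variables and \<open>Suc i\<close> for the fresh
  block \<open>i\<close>, so that all variables are natural numbers and every number is one of the
  two kinds.\<close>

definition main_var :: "nat \<Rightarrow> nat" where
  "main_var x = prod_encode (0, x)"

definition fresh_var :: "nat \<Rightarrow> nat \<Rightarrow> nat" where
  "fresh_var i j = prod_encode (Suc i, j)"

lemma var_simps [simp]:
  "main_var x = main_var y \<longleftrightarrow> x = y"
  "fresh_var i j = fresh_var i' j' \<longleftrightarrow> i = i' \<and> j = j'"
  "main_var x \<noteq> fresh_var i j" "fresh_var i j \<noteq> main_var x"
  by (auto simp: main_var_def fresh_var_def)

lemma var_cases:
  obtains (main) x where "v = main_var x" | (fresh) i j where "v = fresh_var i j"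
proof -
  obtain a b where "v = prod_encode (a, b)" by (metis prod_decode_inverse surj_pair)
  then show ?thesis
    using that by (cases a) (auto simp: main_var_def fresh_var_def)
qed

definition neg_clause :: "nat set \<Rightarrow> nat clause" where
  "neg_clause D = (\<lambda>x. Neg (main_var x)) ` D"

text \<open>The set \<open>s\<close> is a sign pattern on the \<open>l\<close> variables of block
  \<open>i\<close>: its members occur positively, the others negatively. Every assignment falsifies
  the padding of exactly one pattern.\<close>

definition padded_clause :: "nat \<Rightarrow> nat set \<Rightarrow> nat \<Rightarrow> nat set \<Rightarrow> nat clause" where
  "padded_clause l C i s =
     (\<lambda>x. Pos (main_var x)) ` C \<union> (\<lambda>j. Pos (fresh_var i j)) ` s \<union>
     (\<lambda>j. Neg (fresh_var i j)) ` ({..<l} - s)"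

lemma card_neg_clause: "card (neg_clause D) = card D"
  unfolding neg_clause_def by (intro card_image) (auto simp: inj_on_def)

lemma card_padded_clause:
  assumes "finite C" "s \<subseteq> {..<l}"
  shows "card (padded_clause l C i s) = card C + l"
proof -
  have s: "finite s" using assms(2) by (rule finite_subset) simp
  have "card (padded_clause l C i s) = card C + card s + card ({..<l} - s)"
    unfolding padded_clause_def using assms s
    by (subst card_Un_disjoint; (subst card_Un_disjoint)?)
       (auto simp: card_image inj_on_def)
  also have "\<dots> = card C + l"
    using assms s card_mono[of "{..<l}" s] by (simp add: card_Diff_subset)
  finally show ?thesis .
qed

text \<open>The map e names the block of fresh variables of each positive clause.\<close>

definition cover_cnf :: "nat \<Rightarrow> (nat set \<Rightarrow> nat) \<Rightarrow> nat set set \<Rightarrow> nat set set \<Rightarrow> nat cnf" where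
  "cover_cnf l e P Q =
     (\<lambda>(C, s). padded_clause l C (e C) s) ` (P \<times> Pow {..<l}) \<union> neg_clause ` Q"

lemma is_k_cnf_cover_cnf:
  assumes "finite P" "finite Q"
    and P: "\<And>C. C \<in> P \<Longrightarrow> finite C \<and> card C + l = k"
    and Q: "\<And>D. D \<in> Q \<Longrightarrow> finite D \<and> card D = k"
  shows "is_k_cnf k (cover_cnf l e P Q)"
proof -
  have "is_clause X \<and> card X = k" if X: "X \<in> cover_cnf l e P Q" for X
  proof -
    from X consider C s where "C \<in> P" "s \<subseteq> {..<l}" "X = padded_clause l C (e C) s"
      | D where "D \<in> Q" "X = neg_clause D"
      by (auto simp: cover_cnf_def)
    then show ?thesis
    proof cases
      case 1
      then show ?thesis
        using P[of C] card_padded_clause[of C s l "e C"]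
        by (auto simp: is_clause_def padded_clause_def intro: finite_subset)
    next
      case 2
      then show ?thesis
        using Q[of D] card_neg_clause[of D] by (auto simp: is_clause_def neg_clause_def)
    qed
  qed
  then show ?thesis
    using assms(1,2) by (auto simp: is_k_cnf_def is_cnf_def cover_cnf_def)
qed

text \<open>Take \<open>Z\<close> to be the main variables that an assignment makes false: a
  positive clause inside \<open>Z\<close> or a negative clause outside \<open>Z\<close> is
  falsified.\<close>

lemma cover_cnf_unsatisfiable:
  assumes "\<And>Z. Z \<subseteq> {..<n} \<Longrightarrow> (\<exists>C\<in>P. C \<subseteq> Z) \<or> (\<exists>D\<in>Q. D \<subseteq> {..<n} - Z)"
  shows "\<not> satisfiable (cover_cnf l e P Q)"
proof
  assume "satisfiable (cover_cnf l e P Q)"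
  then obtain \<alpha> where \<alpha>: "\<And>X. X \<in> cover_cnf l e P Q \<Longrightarrow> \<exists>u\<in>X. lit_true \<alpha> u"
    by (auto simp: satisfiable_def satisfies_def)
  define Z where "Z = {x \<in> {..<n}. \<not> \<alpha> (main_var x)}"
  have "Z \<subseteq> {..<n}" by (auto simp: Z_def)
  from assms[OF this] show False
  proof (elim disjE bexE)
    fix C assume C: "C \<in> P" "C \<subseteq> Z"
    \<comment> \<open>The pattern opposite to \<open>\<alpha>\<close>, for which all padding
      literals are false.\<close>
    define s where "s = {j \<in> {..<l}. \<not> \<alpha> (fresh_var (e C) j)}"
    have "padded_clause l C (e C) s \<in> cover_cnf l e P Q"
      using C by (force simp: cover_cnf_def s_def)
    from \<alpha>[OF this] C show False
      by (auto simp: padded_clause_def s_def Z_def)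
  next
    fix D assume D: "D \<in> Q" "D \<subseteq> {..<n} - Z"
    then have "neg_clause D \<in> cover_cnf l e P Q" by (auto simp: cover_cnf_def)
    from \<alpha>[OF this] D show False by (auto simp: neg_clause_def Z_def)
  qed
qed

text \<open>A main variable is positive only in padded clauses and negative only in clauses from
  \<open>Q\<close>. A fresh variable lives in the paddings of a single clause because
  \<open>e\<close> is injective; the crude count \<open>2 ^ l\<close> per sign is enough.\<close>

lemma occ_cover_cnf:
  assumes P: "finite P" and Q: "finite Q" and e: "inj_on e P"
  shows "occ (cover_cnf l e P Q) (Pos v) * occ (cover_cnf l e P Q) (Neg v)
           \<le> max (card P * 2 ^ l * card Q) (4 ^ l)"
proof (cases v rule: var_cases)
  case (main x)
  have "{X \<in> cover_cnf l e P Q. Pos v \<in> X} \<subseteq>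
          (\<lambda>(C, s). padded_clause l C (e C) s) ` (P \<times> Pow {..<l})"
    using main by (auto simp: cover_cnf_def neg_clause_def)
  then have "occ (cover_cnf l e P Q) (Pos v) \<le> card (P \<times> Pow {..<l})"
    unfolding occ_def using P by (intro surj_card_le) auto
  moreover have "{X \<in> cover_cnf l e P Q. Neg v \<in> X} \<subseteq> neg_clause ` Q"
    using main by (auto simp: cover_cnf_def padded_clause_def)
  then have "occ (cover_cnf l e P Q) (Neg v) \<le> card Q"
    unfolding occ_def using Q by (intro surj_card_le)
  ultimately have "occ (cover_cnf l e P Q) (Pos v) * occ (cover_cnf l e P Q) (Neg v)
      \<le> card (P \<times> Pow {..<l}) * card Q"
    by (rule mult_le_mono)
  then show ?thesis by (simp add: card_cartesian_product card_Pow)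
next
  case (fresh i j)
  have "occ (cover_cnf l e P Q) u \<le> 2 ^ l" if u: "u \<in> {Pos v, Neg v}" for u
  proof -
    \<comment> \<open>Inverting \<open>e\<close> recovers the only clause of \<open>P\<close> that
      can own block \<open>i\<close>.\<close>
    have "{X \<in> cover_cnf l e P Q. u \<in> X} \<subseteq>
            (\<lambda>s. padded_clause l (the_inv_into P e i) i s) ` Pow {..<l}"
      using u fresh the_inv_into_f_f[OF e]
      by (auto simp: cover_cnf_def neg_clause_def) (auto simp: padded_clause_def)
    then have "occ (cover_cnf l e P Q) u \<le> card (Pow {..<l})"
      unfolding occ_def by (intro surj_card_le) auto
    then show ?thesis by (simp add: card_Pow)
  qed
  then have "occ (cover_cnf l e P Q) (Pos v) * occ (cover_cnf l e P Q) (Neg v) \<le> 2 ^ l * 2 ^ l"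
    by (intro mult_le_mono) auto
  also have "\<dots> = (4::nat) ^ l" by (simp flip: power_mult_distrib)
  finally show ?thesis by simp
qed

section \<open>Choice of parameters and growth rates\<close>

lemma exists_low_product_cnf:
  defines "m \<equiv> \<lambda>k. 7 * k div 34"
  shows "\<exists>F :: nat cnf. is_k_cnf k F \<and> \<not> satisfiable F \<and>
    (\<forall>x. real (occ F (Pos x) * occ F (Neg x)) \<le>
       (20000 * real k + 2)\<^sup>2 * ((1 / 0.3414) ^ m k * (2 / 0.8292) ^ k) + 4 ^ (k - m k))"
proof -
  \<comment> \<open>The thresholds below leave slack exactly \<open>k\<close>:
    \<open>3415 * k = 0.1707 * n + k\<close> and \<open>16585 * k = 0.8292 * n + k\<close>. They add
    up to \<open>n\<close>, so each \<open>Z\<close> or its complement reaches its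
    threshold.\<close>
  define n where "n = 20000 * k"
  have m: "m k \<le> k" by (simp add: m_def)
  obtain P where P: "\<forall>C\<in>P. C \<subseteq> {..<n} \<and> card C = m k" "finite P"
      "card P \<le> (n + 2) / 0.1707 ^ m k"
      "\<forall>Z \<subseteq> {..<n}. 3415 * k \<le> card Z \<longrightarrow> (\<exists>C\<in>P. C \<subseteq> Z)"
    using small_subset_cover[of "0.1707" n "m k" "3415 * k"] m by (auto simp: n_def)
  obtain Q where Q: "\<forall>C\<in>Q. C \<subseteq> {..<n} \<and> card C = k" "finite Q"
      "card Q \<le> (n + 2) / 0.8292 ^ k"
      "\<forall>Z \<subseteq> {..<n}. 16585 * k \<le> card Z \<longrightarrow> (\<exists>C\<in>Q. C \<subseteq> Z)"
    using small_subset_cover[of "0.8292" n k "16585 * k"] by (auto simp: n_def)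
  obtain e :: "nat set \<Rightarrow> nat" where e: "inj_on e P"
    using finite_imp_inj_to_nat_seg[OF P(2)] by blast
  define F where "F = cover_cnf (k - m k) e P Q"
  have "finite C" if "C \<in> P \<union> Q" for C
    using P(1) Q(1) that by (meson UnE finite_lessThan finite_subset)
  then have "is_k_cnf k F"
    unfolding F_def using P(1,2) Q(1,2) m by (intro is_k_cnf_cover_cnf) auto
  moreover have "\<not> satisfiable F"
    unfolding F_def
  proof (rule cover_cnf_unsatisfiable[where n = n])
    fix Z assume Z: "Z \<subseteq> {..<n}"
    then have "card Z + card ({..<n} - Z) = n"
      using card_mono[of "{..<n}" Z] by (simp add: card_Diff_subset finite_subset)
    then have "3415 * k \<le> card Z \<or> 16585 * k \<le> card ({..<n} - Z)"
      by (auto simp: n_def)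
    then show "(\<exists>C\<in>P. C \<subseteq> Z) \<or> (\<exists>D\<in>Q. D \<subseteq> {..<n} - Z)"
      using P(4) Q(4) Z by (metis Diff_subset)
  qed
  moreover have "real (occ F (Pos x) * occ F (Neg x)) \<le>
       (20000 * real k + 2)\<^sup>2 * ((1 / 0.3414) ^ m k * (2 / 0.8292) ^ k) + 4 ^ (k - m k)" for x
  proof -
    have two_ne_zero: "(2 :: real) \<noteq> 0" by simp
    have "real (card P) * 2 ^ (k - m k) * card Q \<le>
            ((n + 2) / 0.1707 ^ m k) * 2 ^ (k - m k) * ((n + 2) / 0.8292 ^ k)"
      using P(3) Q(3) by (intro mult_mono) auto
    \<comment> \<open>Splitting \<open>2 ^ (k - m k)\<close> as \<open>2 ^ k / 2 ^ m k\<close> puts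
      one 2 into each base.\<close>
    also have "\<dots> = (real n + 2)\<^sup>2 * ((1 / (0.1707 * 2)) ^ m k * (2 / 0.8292) ^ k)"
      unfolding power_diff[OF two_ne_zero m] power_divide power_mult_distrib power2_eq_square
      by (simp add: add.commute)
    finally have *: "real (card P * 2 ^ (k - m k) * card Q) \<le>
        (20000 * real k + 2)\<^sup>2 * ((1 / 0.3414) ^ m k * (2 / 0.8292) ^ k)"
      by (simp add: n_def)
    have "real (occ F (Pos x) * occ F (Neg x)) \<le>
            max (card P * 2 ^ (k - m k) * card Q) (4 ^ (k - m k))"
      using occ_cover_cnf[OF P(2) Q(2) e, of "k - m k" x] unfolding F_def
      by (simp only: of_nat_le_iff)
    also have "\<dots> \<le> real (card P * 2 ^ (k - m k) * card Q) + 4 ^ (k - m k)"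
      by (simp add: max_def)
    finally show ?thesis using * by linarith
  qed
  ultimately show ?thesis by blast
qed

text \<open>The 34th power clears the denominator of the exponent and leaves a numerical comparison.
  Rounding down only helps, since the base \<open>1 / 0.3414\<close> exceeds 1.\<close>

lemma main_var_growth:
  "(1 / 0.3414) ^ (7 * k div 34) * (2 / 0.8292) ^ k \<le> (3.0098 :: real) ^ k"
proof (rule iffD1[OF power_mono_iff[where n = 34]])
  have num: "(1 / 0.3414) ^ 7 * (2 / 0.8292) ^ 34 \<le> (3.0098 :: real) ^ 34"
    by (simp add: power_divide)
  have "((1 / 0.3414) ^ (7 * k div 34) * (2 / 0.8292) ^ k) ^ 34
      = (1 / 0.3414 :: real) ^ (34 * (7 * k div 34)) * (2 / 0.8292) ^ (34 * k)"
    by (simp only: power_mult_distrib power_mult[symmetric] mult.commute[of _ 34])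
  also have "\<dots> \<le> (1 / 0.3414) ^ (7 * k) * (2 / 0.8292) ^ (34 * k)"
    by (intro mult_right_mono power_increasing) auto
  also have "\<dots> = ((1 / 0.3414) ^ 7 * (2 / 0.8292) ^ 34) ^ k"
    by (simp only: power_mult_distrib power_mult)
  also have "\<dots> \<le> (3.0098 ^ 34) ^ k"
    by (rule power_mono[OF num]) simp
  also have "\<dots> = (3.0098 ^ k) ^ 34"
    by (simp only: power_mult[symmetric] mult.commute)
  finally show "((1 / 0.3414) ^ (7 * k div 34) * (2 / 0.8292) ^ k) ^ 34
      \<le> ((3.0098 :: real) ^ k) ^ 34" .
qed simp_all

text \<open>Again by 34th powers, but here rounding down enlarges the exponent by less than 1; the
  factor 4 pays for it.\<close>

lemma fresh_var_growth:
  "4 ^ (k - 7 * k div 34) \<le> 4 * (3.01 :: real) ^ k"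
proof (rule iffD1[OF power_mono_iff[where n = 34]])
  have num: "4 ^ 27 \<le> (3.01 :: real) ^ 34"
    by (simp add: power_divide)
  have "(4 ^ (k - 7 * k div 34)) ^ 34 = (4 :: real) ^ (34 * (k - 7 * k div 34))"
    by (simp only: power_mult[symmetric] mult.commute)
  also have "\<dots> \<le> 4 ^ (34 + 27 * k)" by (intro power_increasing) auto
  also have "\<dots> = 4 ^ 34 * (4 ^ 27) ^ k" by (simp only: power_add power_mult)
  also have "\<dots> \<le> 4 ^ 34 * (3.01 ^ 34) ^ k"
    by (intro mult_left_mono power_mono[OF num]) simp_all
  also have "\<dots> = (4 * 3.01 ^ k) ^ 34"
    by (simp only: power_mult_distrib power_mult[symmetric] mult.commute[of _ 34])
  finally show "(4 ^ (k - 7 * k div 34)) ^ 34 \<le> (4 * (3.01 :: real) ^ k) ^ 34" .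
qed simp_all

theorem theorem3:
  shows "\<exists>F :: nat \<Rightarrow> nat cnf.
           (\<forall>k. is_k_cnf k (F k) \<and> \<not> satisfiable (F k)) \<and>
           (\<exists>f :: nat \<Rightarrow> real. f \<in> O(\<lambda>k. 3.01 ^ k) \<and>
              (\<forall>k x. real (occ (F k) (Pos x) * occ (F k) (Neg x)) \<le> f k))"
proof -
  \<comment> \<open>The gap between 3.0098 and 3.01 absorbs the quadratic factor.\<close>
  define f :: "nat \<Rightarrow> real" where
    "f k = (20000 * real k + 2)\<^sup>2 * 3.0098 ^ k + 4 * 3.01 ^ k" for k
  have bound: "(20000 * real k + 2)\<^sup>2 * ((1 / 0.3414) ^ (7 * k div 34) * (2 / 0.8292) ^ k)
      + 4 ^ (k - 7 * k div 34) \<le> f k" for k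
    unfolding f_def
    by (intro add_mono mult_left_mono main_var_growth fresh_var_growth) simp
  have "\<exists>F :: nat cnf. is_k_cnf k F \<and> \<not> satisfiable F \<and>
      (\<forall>x. real (occ F (Pos x) * occ F (Neg x)) \<le> f k)" for k
    using exists_low_product_cnf[of k] bound[of k] by (meson order_trans)
  then obtain F :: "nat \<Rightarrow> nat cnf" where
    "\<And>k. is_k_cnf k (F k) \<and> \<not> satisfiable (F k) \<and>
      (\<forall>x. real (occ (F k) (Pos x) * occ (F k) (Neg x)) \<le> f k)"
    by metis
  moreover have "f \<in> O(\<lambda>k. 3.01 ^ k)"
    unfolding f_def by real_asymp
  ultimately show ?thesis by blast
qed

end
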